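(* Let $d\ge 2$, let $x_1,\dots,x_n\in\mathbb{S}^{d-1}$ and $\alpha_1,\dots,\alpha_n>0$. Then $$\int_{\mathbb{B}^d}\left|\sum_{k=1}^n \alpha_k\frac{x_k-x}{|x_k-x|^d}\right|\,dm(x)\ \ge\ c_d\,\frac{\sum_{k=1}^n\alpha_k^{1+\frac{2}{d}}}{\sum_{k=1}^n\alpha_k^{\frac{2}{d}}},$$ where $c_d>0$ is a constant depending only on $d$ (not on $n$, the points $x_k$, or the weights $\alpha_k$).
   Context: $\mathbb{S}^{d-1}$ and $\mathbb{B}^d$ denote the unit sphere and the open unit ball of $\mathbb{R}^d$; $m$ is Lebesgue measure on $\mathbb{R}^d$; $|\cdot|$ is the Euclidean norm. *)

theory Defs
  imports "HOL-Analysis.Analysis"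
begin

end

theory Submission
  imports Defs
begin

text \<open>
  Write \<open>F\<close> for the vector field and \<open>A\<close> for the sum of the weights. Since \<open>norm (p k) = 1\<close>, the radial
  component \<open>x \<bullet> F x\<close> is half the difference of the Poisson sum of the
  \<open>\<alpha> k (1 - |x|^2) / |p k - x|^d\<close> and the Newtonian sum of the \<open>\<alpha> k |p k - x|^(2-d)\<close>.
  Put \<open>r k = t \<alpha> k / A\<close> with a small \<open>t\<close> depending only on \<open>d\<close>. On the ball of radius \<open>r k\<close> about
  \<open>(1 - 2 r k) p k\<close> the \<open>k\<close>-th Poisson term is of order \<open>\<alpha> k (r k)^(1-d)\<close>, while all points of the
  sphere have distance at least \<open>r k\<close>, so the Newtonian sum is at most
  \<open>A (r k)^(2-d) = t \<alpha> k (r k)^(1-d)\<close>. The Poisson terms are positive, so overlaps of these balls do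
  no harm, and integrating gives a lower bound of order
  \<open>(\<Sum>k. \<alpha> k * r k) = t (\<Sum>k. (\<alpha> k)^2) / A\<close>. This Lehmer mean of the weights dominates the one
  with exponent \<open>2 / d\<close>.
\<close>

text \<open>The second factor is
  \<open>a powr s * b powr s * (a powr (1 - s) - b powr (1 - s))\<close>. Since \<open>1 - s\<close>
  is nonnegative, it never has the sign opposite to \<open>a - b\<close>.\<close>

lemma mult_powr_diff_nonneg:
  fixes a b s :: real
  assumes "0 < a" "0 < b" "s \<le> 1"
  shows "0 \<le> (a - b) * (a * b powr s - b * a powr s)"
proof -
  have *: "y * x powr s \<le> x * y powr s" if "0 < y" "y \<le> x" for x y :: real
  proof -
    have "y powr (1 - s) \<le> x powr (1 - s)"
      using that assms(3) by (intro powr_mono2) auto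
    then have "y powr (1 - s) * (x powr s * y powr s) \<le> x powr (1 - s) * (x powr s * y powr s)"
      by (intro mult_right_mono) auto
    moreover have "y powr (1 - s) * y powr s = y" "x powr (1 - s) * x powr s = x"
      using that by (simp_all flip: powr_add)
    ultimately show ?thesis
      by (metis mult.assoc mult.commute)
  qed
  show ?thesis
    using *[of a b] *[of b a] assms(1,2)
    by (cases "a \<le> b") (auto intro: mult_nonneg_nonneg mult_nonpos_nonpos)
qed

text \<open>A Chebyshev sum argument: after cross-multiplying, the difference of the two sides is a
  double sum over \<open>i\<close> and \<open>j\<close>. Symmetrising it pairs its terms into the
  nonnegative products of \<open>mult_powr_diff_nonneg\<close>.\<close>

lemma Lehmer_mean_le_2:
  fixes f :: "'i \<Rightarrow> real"
  assumes pos: "\<And>i. i \<in> I \<Longrightarrow> 0 < f i" and "s \<le> 1"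
  shows "(\<Sum>i\<in>I. f i powr (1 + s)) / (\<Sum>i\<in>I. f i powr s) \<le> (\<Sum>i\<in>I. (f i)\<^sup>2) / (\<Sum>i\<in>I. f i)"
\<comment> \<open>Otherwise all four sums are 0, and both quotients are 0 by the convention for
  division by zero.\<close>
proof (cases "finite I \<and> I \<noteq> {}")
  case True
  let ?D = "\<lambda>i j. (f i)\<^sup>2 * f j powr s - f i powr (1 + s) * f j"
  have "0 \<le> (\<Sum>i\<in>I. \<Sum>j\<in>I. (f i - f j) * (f i * f j powr s - f j * f i powr s))"
    using pos \<open>s \<le> 1\<close> by (intro sum_nonneg mult_powr_diff_nonneg) auto
  also have "\<dots> = (\<Sum>i\<in>I. \<Sum>j\<in>I. ?D i j + ?D j i)"
    using pos by (intro sum.cong refl) (simp add: powr_add power2_eq_square algebra_simps abs_of_pos)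
  also have "\<dots> = 2 * (\<Sum>i\<in>I. \<Sum>j\<in>I. ?D i j)"
    using sum.swap[of "\<lambda>i j. ?D j i" I I] by (simp add: sum.distrib)
  also have "(\<Sum>i\<in>I. \<Sum>j\<in>I. ?D i j) =
      (\<Sum>i\<in>I. (f i)\<^sup>2) * (\<Sum>i\<in>I. f i powr s) - (\<Sum>i\<in>I. f i powr (1 + s)) * (\<Sum>i\<in>I. f i)"
    by (simp add: sum_subtractf sum_product)
  finally have "(\<Sum>i\<in>I. f i powr (1 + s)) * (\<Sum>i\<in>I. f i) \<le> (\<Sum>i\<in>I. (f i)\<^sup>2) * (\<Sum>i\<in>I. f i powr s)"
    by simp
  moreover have "0 < (\<Sum>i\<in>I. f i)" "0 < (\<Sum>i\<in>I. f i powr s)"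
    using True pos by (auto intro!: sum_pos simp: less_imp_neq[symmetric])
  ultimately show ?thesis
    by (simp add: divide_simps)
qed auto

text \<open>Dividing by \<open>norm (p - x) ^ d\<close> splits the radial component of one summand
  into its Poisson and Newtonian parts.\<close>

lemma inner_diff_unit:
  fixes p x :: "'a::real_inner"
  assumes "norm p = 1"
  shows "x \<bullet> (p - x) = (1 - (norm x)\<^sup>2 - (norm (p - x))\<^sup>2) / 2"
proof -
  have "p \<bullet> p = 1"
    using assms by (simp add: dot_square_norm)
  then show ?thesis
    by (simp add: power2_norm_eq_inner algebra_simps inner_commute)
qed

text \<open>Both sides are Newtonian kernels with exponent \<open>2 - d\<close>. The quotient form
  avoids truncated subtraction in the exponent.\<close>

lemma square_over_power_antimono:
  fixes r u :: real
  assumes "0 < r" "r \<le> u" "2 \<le> d"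
  shows "u\<^sup>2 / u ^ d \<le> r\<^sup>2 / r ^ d"
proof -
  obtain e where d: "d = e + 2"
    using assms(3) by (metis add.commute le_Suc_ex)
  have "1 / u ^ e \<le> 1 / r ^ e"
    using assms by (intro divide_left_mono power_mono) auto
  then show ?thesis
    using assms by (simp add: d power_add power2_eq_square)
qed

text \<open>The centre lies at depth \<open>2 * r\<close> below \<open>p\<close>, so moving by less
  than \<open>r\<close> leaves the depth above \<open>r\<close> and the distance to \<open>p\<close>
  below \<open>3 * r\<close>. The last bound follows from
  \<open>1 - norm x \<le> 1 - (norm x)\<^sup>2\<close>.\<close>

lemma inner_ball_bounds:
  fixes p x :: "'a::real_normed_vector"
  assumes "norm p = 1" "0 < r" "r \<le> 1 / 4" and x: "x \<in> ball ((1 - 2 * r) *\<^sub>R p) r"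
  shows "norm x < 1 - r" "norm (p - x) \<le> 3 * r" "r \<le> 1 - (norm x)\<^sup>2"
proof -
  have c: "norm ((1 - 2 * r) *\<^sub>R p) = 1 - 2 * r" "norm (p - (1 - 2 * r) *\<^sub>R p) = 2 * r"
    using assms(1-3) norm_scaleR[of "2 * r" p] by (simp, simp add: scaleR_left_diff_distrib)
  have x': "norm ((1 - 2 * r) *\<^sub>R p - x) < r"
    using x by (simp add: dist_norm)
  show *: "norm x < 1 - r"
    using norm_triangle_ineq2[of x "(1 - 2 * r) *\<^sub>R p"] x' c by (simp add: norm_minus_commute)
  show "norm (p - x) \<le> 3 * r"
    using norm_triangle_ineq[of "p - (1 - 2 * r) *\<^sub>R p" "(1 - 2 * r) *\<^sub>R p - x"] x' c by simp
  have "(norm x)\<^sup>2 \<le> norm x"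
    using * assms(2) by (simp add: power2_eq_square mult_left_le)
  then show "r \<le> 1 - (norm x)\<^sup>2"
    using * by simp
qed

text \<open>The left side charges the full Newtonian bound once for every ball containing
  \<open>x\<close>. This is wasteful, but it leaves one multiple of an indicator per index, so that
  integrating needs only the volume of each ball.\<close>

lemma norm_field_ge:
  fixes p :: "'i \<Rightarrow> 'a::euclidean_space" and x :: 'a
  assumes "finite I" and d: "2 \<le> d"
    and p: "\<And>i. i \<in> I \<Longrightarrow> norm (p i) = 1"
    and \<alpha>: "\<And>i. i \<in> I \<Longrightarrow> 0 < \<alpha> i"
    and r: "\<And>i. i \<in> I \<Longrightarrow> 0 < r i \<and> r i \<le> 1 / 4"
    and x: "norm x < 1"
  shows "(\<Sum>i\<in>I. (\<alpha> i * r i / (3 * r i) ^ d - sum \<alpha> I * ((r i)\<^sup>2 / r i ^ d)) / 2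
             * indicator (ball ((1 - 2 * r i) *\<^sub>R p i) (r i)) x)
    \<le> norm (\<Sum>i\<in>I. (\<alpha> i / norm (p i - x) ^ d) *\<^sub>R (p i - x))"
proof -
  define K where "K = {i \<in> I. x \<in> ball ((1 - 2 * r i) *\<^sub>R p i) (r i)}"
  have K: "K \<subseteq> I" "finite K"
    using \<open>finite I\<close> by (auto simp: K_def)
  let ?F = "\<Sum>i\<in>I. (\<alpha> i / norm (p i - x) ^ d) *\<^sub>R (p i - x)"
  let ?P = "\<lambda>i. \<alpha> i * (1 - (norm x)\<^sup>2) / norm (p i - x) ^ d"
  let ?N = "\<lambda>i. \<alpha> i * ((norm (p i - x))\<^sup>2 / norm (p i - x) ^ d)"
  have dist_pos: "0 < norm (p i - x)" if "i \<in> I" for i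
    using p[OF that] x by auto
  have x1: "(norm x)\<^sup>2 \<le> 1"
    using x by (simp add: power_le_one)
  have "(\<Sum>i\<in>I. (\<alpha> i * r i / (3 * r i) ^ d - sum \<alpha> I * ((r i)\<^sup>2 / r i ^ d)) / 2
             * indicator (ball ((1 - 2 * r i) *\<^sub>R p i) (r i)) x)
      = (\<Sum>i\<in>K. (\<alpha> i * r i / (3 * r i) ^ d - sum \<alpha> I * ((r i)\<^sup>2 / r i ^ d)) / 2)"
    using \<open>finite I\<close> unfolding K_def by (subst sum.inter_filter) (auto intro!: sum.cong)
  also have "\<dots> = ((\<Sum>i\<in>K. \<alpha> i * r i / (3 * r i) ^ d) - (\<Sum>i\<in>K. sum \<alpha> I * ((r i)\<^sup>2 / r i ^ d))) / 2"
    by (simp add: sum_subtractf flip: sum_divide_distrib)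
  also have "\<dots> \<le> norm ?F"
  proof (cases "K = {}")
    case False
    \<comment> \<open>A single ball around \<open>x\<close> already controls the whole Newtonian
      sum. The bounds attached to the other indices in \<open>K\<close> only enlarge what is
      subtracted.\<close>
    then obtain k where k: "k \<in> K" by blast
    have "(\<Sum>i\<in>K. \<alpha> i * r i / (3 * r i) ^ d) \<le> (\<Sum>i\<in>K. ?P i)"
    proof (rule sum_mono)
      fix i assume i: "i \<in> K"
      then have "i \<in> I" using K by blast
      then show "\<alpha> i * r i / (3 * r i) ^ d \<le> ?P i"
        using inner_ball_bounds[of "p i" "r i" x] i r[of i] p[of i] \<alpha>[of i] dist_pos[of i]
        by (intro frac_le mult_mono power_mono zero_less_power mult_nonneg_nonneg) (auto simp: K_def)
    qed
    also have "\<dots> \<le> (\<Sum>i\<in>I. ?P i)"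
      using K \<open>finite I\<close> x1
      by (intro sum_mono2) (auto intro!: divide_nonneg_nonneg mult_nonneg_nonneg less_imp_le[OF \<alpha>])
    finally have poisson: "(\<Sum>i\<in>K. \<alpha> i * r i / (3 * r i) ^ d) \<le> (\<Sum>i\<in>I. ?P i)" .
    have "(\<Sum>i\<in>I. ?N i) \<le> (\<Sum>i\<in>I. \<alpha> i * ((r k)\<^sup>2 / r k ^ d))"
    proof (rule sum_mono)
      fix i assume i: "i \<in> I"
      have "k \<in> I" using k K by blast
      then have "norm x < 1 - r k"
        using inner_ball_bounds(1)[of "p k" "r k" x] k r[of k] p[of k] by (auto simp: K_def)
      then have "r k \<le> norm (p i - x)"
        using norm_triangle_ineq2[of "p i" x] p[OF i] by simp
      then show "?N i \<le> \<alpha> i * ((r k)\<^sup>2 / r k ^ d)"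
        using r[OF \<open>k \<in> I\<close>] \<alpha>[OF i] d by (intro mult_left_mono square_over_power_antimono) auto
    qed
    also have "\<dots> = sum \<alpha> I * ((r k)\<^sup>2 / r k ^ d)"
      by (rule sum_distrib_right[symmetric])
    also have "\<dots> \<le> (\<Sum>i\<in>K. sum \<alpha> I * ((r i)\<^sup>2 / r i ^ d))"
    proof (rule member_le_sum[OF k _ \<open>finite K\<close>])
      fix i assume "i \<in> K - {k}"
      then have "0 < r i" using r K by blast
      moreover have "0 \<le> sum \<alpha> I" using \<alpha> by (intro sum_nonneg) (auto intro: less_imp_le)
      ultimately show "0 \<le> sum \<alpha> I * ((r i)\<^sup>2 / r i ^ d)" by simp
    qed
    finally have newton: "(\<Sum>i\<in>I. ?N i) \<le> (\<Sum>i\<in>K. sum \<alpha> I * ((r i)\<^sup>2 / r i ^ d))" .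
    have "((\<Sum>i\<in>I. ?P i) - (\<Sum>i\<in>I. ?N i)) / 2 = (\<Sum>i\<in>I. (?P i - ?N i) / 2)"
      by (simp add: sum_subtractf flip: sum_divide_distrib)
    also have "\<dots> = x \<bullet> ?F"
      unfolding inner_sum_right
      by (intro sum.cong refl) (simp add: inner_diff_unit p diff_divide_distrib right_diff_distrib)
    \<comment> \<open>Only the radial component has been estimated; as \<open>norm x < 1\<close>, it
      is at most the norm of the field.\<close>
    also have "\<dots> \<le> norm x * norm ?F"
      by (rule norm_cauchy_schwarz)
    also have "\<dots> \<le> norm ?F"
      using x by (intro mult_left_le_one_le) auto
    finally show ?thesis
      using poisson newton by (simp add: divide_right_mono)
  qed simp
  finally show ?thesis .
qed

lemma field_integral_ge:
  fixes p :: "'i \<Rightarrow> 'a::euclidean_space"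
  defines "d \<equiv> DIM('a)"
  defines "t \<equiv> 1 / (2 * 3 ^ d) :: real"
  assumes "finite I" and d: "2 \<le> d"
    and p: "\<And>i. i \<in> I \<Longrightarrow> norm (p i) = 1"
    and \<alpha>: "\<And>i. i \<in> I \<Longrightarrow> 0 < \<alpha> i"
  shows "ennreal (unit_ball_vol d * t\<^sup>2 / 2 * ((\<Sum>i\<in>I. (\<alpha> i)\<^sup>2) / sum \<alpha> I))
    \<le> (\<integral>\<^sup>+ x \<in> ball 0 1. ennreal (norm (\<Sum>i\<in>I. (\<alpha> i / norm (p i - x) ^ d) *\<^sub>R (p i - x))) \<partial>lborel)"
proof -
  let ?A = "sum \<alpha> I"
  define r where "r i = t * \<alpha> i / ?A" for i
  let ?C = "\<lambda>i. ball ((1 - 2 * r i) *\<^sub>R p i) (r i)"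
  define b where "b i = t * \<alpha> i * r i / r i ^ d / 2" for i
  have "1 \<le> (3::real) ^ d" "(3::real)\<^sup>2 \<le> 3 ^ d"
    using d by (simp, intro power_increasing) auto
  then have t: "0 < t" "t \<le> 1 / 4"
    by (auto simp: t_def field_simps)
  have A: "0 < ?A" "\<alpha> i \<le> ?A" if "i \<in> I" for i
  proof -
    show "0 < ?A" using \<open>finite I\<close> that \<alpha> by (intro sum_pos) auto
    show "\<alpha> i \<le> ?A" using \<open>finite I\<close> that \<alpha> by (intro member_le_sum) (auto intro: less_imp_le)
  qed
  have r: "0 < r i \<and> r i \<le> 1 / 4" if "i \<in> I" for i
  proof -
    have "r i = t * (\<alpha> i / ?A)" by (simp add: r_def)
    also have "\<dots> \<le> t * 1"
      using A[OF that] t by (intro mult_left_mono) auto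
    finally have "r i \<le> 1 / 4"
      using t by simp
    moreover have "0 < r i"
      using A[OF that] t \<alpha>[OF that] by (simp add: r_def)
    ultimately show ?thesis by simp
  qed
  \<comment> \<open>The choice of \<open>t\<close> makes the Poisson bound exactly twice the
    Newtonian one: \<open>1 / 3 ^ d\<close> is \<open>2 * t\<close>, while \<open>?A * r i\<close>
    is \<open>t * \<alpha> i\<close>. Half of their difference is \<open>b i\<close>.\<close>
  have b: "(\<alpha> i * r i / (3 * r i) ^ d - ?A * ((r i)\<^sup>2 / r i ^ d)) / 2 = b i" if "i \<in> I" for i
  proof -
    have "?A * (r i)\<^sup>2 = t * \<alpha> i * r i"
      using A[OF that] by (simp add: r_def power2_eq_square)
    moreover have "\<alpha> i * r i / (3 * r i) ^ d = 2 * (t * \<alpha> i * r i) / r i ^ d"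
      by (simp add: power_mult_distrib t_def)
    ultimately show ?thesis
      by (simp add: b_def diff_divide_distrib)
  qed
  have b0: "0 \<le> b i" if "i \<in> I" for i
    using r[OF that] t \<alpha>[OF that] by (simp add: b_def)
  have sub: "?C i \<subseteq> ball 0 1" if "i \<in> I" for i
  proof
    fix x assume "x \<in> ?C i"
    then have "norm x < 1 - r i"
      using inner_ball_bounds(1) p r that by blast
    then show "x \<in> ball 0 1" using r[OF that] by simp
  qed
  have V: "0 \<le> unit_ball_vol (real d)"
    by (intro unit_ball_vol_nonneg) auto
  have "ennreal (unit_ball_vol d * t\<^sup>2 / 2 * ((\<Sum>i\<in>I. (\<alpha> i)\<^sup>2) / ?A))
      = ennreal (\<Sum>i\<in>I. b i * (unit_ball_vol d * r i ^ d))"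
  proof (intro arg_cong[of _ _ ennreal])
    have "unit_ball_vol d * t\<^sup>2 / 2 * ((\<Sum>i\<in>I. (\<alpha> i)\<^sup>2) / ?A)
        = (\<Sum>i\<in>I. unit_ball_vol d * t\<^sup>2 / 2 * ((\<alpha> i)\<^sup>2 / ?A))"
      by (simp only: sum_distrib_left sum_divide_distrib)
    also have "\<dots> = (\<Sum>i\<in>I. b i * (unit_ball_vol d * r i ^ d))"
    proof (rule sum.cong[OF refl])
      fix i assume i: "i \<in> I"
      \<comment> \<open>The volume of the ball cancels the singular factor
        \<open>1 / r i ^ d\<close>, leaving weight times radius.\<close>
      have "b i * (unit_ball_vol d * r i ^ d) = t * \<alpha> i * r i * unit_ball_vol d / 2"
        using r[OF i] by (simp add: b_def)
      then show "unit_ball_vol d * t\<^sup>2 / 2 * ((\<alpha> i)\<^sup>2 / ?A) = b i * (unit_ball_vol d * r i ^ d)"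
        by (simp add: r_def power2_eq_square mult_ac)
    qed
    finally show "unit_ball_vol d * t\<^sup>2 / 2 * ((\<Sum>i\<in>I. (\<alpha> i)\<^sup>2) / ?A)
      = (\<Sum>i\<in>I. b i * (unit_ball_vol d * r i ^ d))" .
  qed
  also have "\<dots> = (\<Sum>i\<in>I. ennreal (b i) * emeasure lborel (?C i))"
    using b0 r V
    by (subst sum_ennreal[symmetric])
       (auto intro!: sum.cong mult_nonneg_nonneg simp: emeasure_ball d_def less_imp_le ennreal_mult')
  \<comment> \<open>The balls may overlap: the sum of indicators counts multiplicity, and so does
    the bound of \<open>norm_field_ge\<close>.\<close>
  also have "\<dots> = (\<integral>\<^sup>+ x. (\<Sum>i\<in>I. ennreal (b i) * indicator (?C i) x) \<partial>lborel)"
    by (subst nn_integral_sum)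
       (auto simp: nn_integral_cmult_indicator
         intro!: borel_measurable_times_ennreal borel_measurable_indicator)
  also have "\<dots> \<le> (\<integral>\<^sup>+ x \<in> ball 0 1.
      ennreal (norm (\<Sum>i\<in>I. (\<alpha> i / norm (p i - x) ^ d) *\<^sub>R (p i - x))) \<partial>lborel)"
  proof (rule nn_integral_mono)
    fix x :: 'a
    show "(\<Sum>i\<in>I. ennreal (b i) * indicator (?C i) x)
      \<le> ennreal (norm (\<Sum>i\<in>I. (\<alpha> i / norm (p i - x) ^ d) *\<^sub>R (p i - x))) * indicator (ball 0 1) x"
    proof (cases "x \<in> ball 0 1")
      case True
      have "(\<Sum>i\<in>I. ennreal (b i) * indicator (?C i) x) = ennreal (\<Sum>i\<in>I. b i * indicator (?C i) x)"
      proof -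
        have "(\<Sum>i\<in>I. ennreal (b i) * indicator (?C i) x) = (\<Sum>i\<in>I. ennreal (b i * indicator (?C i) x))"
          by (intro sum.cong refl) (simp split: split_indicator)
        then show ?thesis
          using b0 by (simp add: sum_ennreal)
      qed
      also have "(\<Sum>i\<in>I. b i * indicator (?C i) x) =
          (\<Sum>i\<in>I. (\<alpha> i * r i / (3 * r i) ^ d - ?A * ((r i)\<^sup>2 / r i ^ d)) / 2 * indicator (?C i) x)"
        by (intro sum.cong refl) (simp only: b)
      also have "\<dots> \<le> norm (\<Sum>i\<in>I. (\<alpha> i / norm (p i - x) ^ d) *\<^sub>R (p i - x))"
        using True by (intro norm_field_ge \<open>finite I\<close> d p \<alpha> r) auto
      finally show ?thesis
        using True by (simp add: ennreal_leI)
    next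
      case False
      then have "x \<notin> ?C i" if "i \<in> I" for i
        using sub[OF that] by blast
      then have "(\<Sum>i\<in>I. ennreal (b i) * indicator (?C i) x) = 0"
        by (intro sum.neutral ballI) (simp add: indicator_def)
      then show ?thesis by simp
    qed
  qed
  finally show ?thesis .
qed

theorem theorem1p1:
  assumes "DIM('a::euclidean_space) \<ge> 2"
  shows "\<exists>c::real. c > 0 \<and>
    (\<forall>(n::nat) (p::nat \<Rightarrow> 'a) (\<alpha>::nat \<Rightarrow> real).
       (\<forall>k\<in>{1..n}. norm (p k) = 1 \<and> \<alpha> k > 0) \<longrightarrow>
       (\<integral>\<^sup>+ x \<in> ball (0::'a) 1.
          ennreal (norm (\<Sum>k=1..n. (\<alpha> k / norm (p k - x) ^ DIM('a)) *\<^sub>R (p k - x))) \<partial>lborel)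
       \<ge> ennreal (c * ((\<Sum>k=1..n. \<alpha> k powr (1 + 2 / real DIM('a)))
                      / (\<Sum>k=1..n. \<alpha> k powr (2 / real DIM('a))))))"
proof -
  define c where "c = unit_ball_vol DIM('a) * (1 / (2 * 3 ^ DIM('a)))\<^sup>2 / 2"
  have "0 < c"
    by (simp add: c_def)
  moreover have "ennreal (c * ((\<Sum>k=1..n. \<alpha> k powr (1 + 2 / real DIM('a)))
                      / (\<Sum>k=1..n. \<alpha> k powr (2 / real DIM('a)))))
      \<le> (\<integral>\<^sup>+ x \<in> ball (0::'a) 1.
          ennreal (norm (\<Sum>k=1..n. (\<alpha> k / norm (p k - x) ^ DIM('a)) *\<^sub>R (p k - x))) \<partial>lborel)"
    if "\<forall>k\<in>{1..n}. norm (p k) = 1 \<and> \<alpha> k > 0" for n and p :: "nat \<Rightarrow> 'a" and \<alpha> :: "nat \<Rightarrow> real"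
  proof -
    \<comment> \<open>The dimension being at least 2 gives the exponent condition
      \<open>s \<le> 1\<close> for \<open>s = 2 / DIM('a)\<close>.\<close>
    have "(\<Sum>k=1..n. \<alpha> k powr (1 + 2 / real DIM('a))) / (\<Sum>k=1..n. \<alpha> k powr (2 / real DIM('a)))
        \<le> (\<Sum>k=1..n. (\<alpha> k)\<^sup>2) / sum \<alpha> {1..n}"
      using that assms by (intro Lehmer_mean_le_2) auto
    then have "ennreal (c * ((\<Sum>k=1..n. \<alpha> k powr (1 + 2 / real DIM('a)))
                      / (\<Sum>k=1..n. \<alpha> k powr (2 / real DIM('a)))))
        \<le> ennreal (c * ((\<Sum>k=1..n. (\<alpha> k)\<^sup>2) / sum \<alpha> {1..n}))"
      using \<open>0 < c\<close> by (intro ennreal_leI mult_left_mono) auto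
    also have "\<dots> \<le> (\<integral>\<^sup>+ x \<in> ball (0::'a) 1.
          ennreal (norm (\<Sum>k=1..n. (\<alpha> k / norm (p k - x) ^ DIM('a)) *\<^sub>R (p k - x))) \<partial>lborel)"
      unfolding c_def using that assms by (intro field_integral_ge) auto
    finally show ?thesis .
  qed
  ultimately show ?thesis
    by blast
qed

end
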